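(* Let $R=\mathbb F_{q_1}\times\cdots\times\mathbb F_{q_t}$ be a product of $t\ge 3$ finite fields. Then the graph on vertex set $Z(R)^*$ with edge set $E(W\Gamma(R))\setminus E(\Gamma(R))$ has no isolated vertices (so it equals $\mathcal D(R)$), $\mathcal D(R)$ is connected, and $\operatorname{diam}(\mathcal D(R))=2$.
   Context: $Z(R)$ is the set of zero-divisors of $R$ and $Z(R)^*=Z(R)\setminus\{0\}$. $\Gamma(R)$ is the simple graph with vertex set $Z(R)^*$, with distinct $x,y$ adjacent iff $xy=0$. $W\Gamma(R)$ is the simple graph with vertex set $Z(R)^*$, with distinct $x,y$ adjacent iff there exist nonzero $r\in\operatorname{Ann}(x)$ and nonzero $s\in\operatorname{Ann}(y)$ with $rs=0$. The weak zero-divisor difference graph $\mathcal D(R)$ is the graph on $Z(R)^*$ with edge set $E(W\Gamma(R))\setminus E(\Gamma(R))$, with resulting isolated vertices deleted. The diameter is the maximum over pairs of vertices of the length of a shortest path between them. *)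

theory Defs
  imports "HOL-Algebra.Chinese_Remainder" "Graph_Theory.Graph_Theory"
begin

text \<open>As in the library, an undirected graph is represented by a symmetric digraph: an edge
  between \<open>x\<close> and \<open>y\<close> is the pair of arcs \<open>(x, y)\<close> and \<open>(y, x)\<close>. The difference of edge sets
  is then the difference of arc sets.\<close>

definition zero_divisors :: "('a, 'm) ring_scheme \<Rightarrow> 'a set" where
  "zero_divisors R =
     {x \<in> carrier R. \<exists>y \<in> carrier R. y \<noteq> \<zero>\<^bsub>R\<^esub> \<and> x \<otimes>\<^bsub>R\<^esub> y = \<zero>\<^bsub>R\<^esub>}"

definition nonzero_zero_divisors :: "('a, 'm) ring_scheme \<Rightarrow> 'a set" where
  "nonzero_zero_divisors R = zero_divisors R - {\<zero>\<^bsub>R\<^esub>}"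

definition annihilator :: "('a, 'm) ring_scheme \<Rightarrow> 'a \<Rightarrow> 'a set" where
  "annihilator R x = {r \<in> carrier R. r \<otimes>\<^bsub>R\<^esub> x = \<zero>\<^bsub>R\<^esub>}"

definition zero_divisor_graph :: "('a, 'm) ring_scheme \<Rightarrow> 'a pair_pre_digraph" where
  "zero_divisor_graph R =
     \<lparr>pverts = nonzero_zero_divisors R,
      parcs = {(x, y). x \<in> nonzero_zero_divisors R \<and> y \<in> nonzero_zero_divisors R \<and> x \<noteq> y \<and>
                       x \<otimes>\<^bsub>R\<^esub> y = \<zero>\<^bsub>R\<^esub>}\<rparr>"

definition weak_zero_divisor_graph :: "('a, 'm) ring_scheme \<Rightarrow> 'a pair_pre_digraph" where
  "weak_zero_divisor_graph R =
     \<lparr>pverts = nonzero_zero_divisors R,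
      parcs = {(x, y). x \<in> nonzero_zero_divisors R \<and> y \<in> nonzero_zero_divisors R \<and> x \<noteq> y \<and>
                       (\<exists>r \<in> annihilator R x - {\<zero>\<^bsub>R\<^esub>}. \<exists>s \<in> annihilator R y - {\<zero>\<^bsub>R\<^esub>}.
                          r \<otimes>\<^bsub>R\<^esub> s = \<zero>\<^bsub>R\<^esub>)}\<rparr>"

definition weak_minus_zero_divisor_graph :: "('a, 'm) ring_scheme \<Rightarrow> 'a pair_pre_digraph" where
  "weak_minus_zero_divisor_graph R =
     \<lparr>pverts = nonzero_zero_divisors R,
      parcs = parcs (weak_zero_divisor_graph R) - parcs (zero_divisor_graph R)\<rparr>"

definition isolated_verts :: "'a pair_pre_digraph \<Rightarrow> 'a set" where
  "isolated_verts G =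
     {v \<in> pverts G. \<forall>w. (v, w) \<notin> parcs G \<and> (w, v) \<notin> parcs G}"

definition weak_zero_divisor_difference_graph ::
    "('a, 'm) ring_scheme \<Rightarrow> 'a pair_pre_digraph" where
  "weak_zero_divisor_difference_graph R =
     (let G = weak_minus_zero_divisor_graph R
      in \<lparr>pverts = pverts G - isolated_verts G, parcs = parcs G\<rparr>)"

text \<open>\<open>wf_digraph.\<mu> G (\<lambda>_. 1) u v\<close> is the least number of arcs on a walk from \<open>u\<close> to \<open>v\<close>, i.e.
  the length of a shortest path (\<open>\<infinity>\<close> if there is none). It is meaningful only for well-formed
  \<open>G\<close>; see the lemmas below.\<close>

definition graph_diameter :: "('a, 'b) pre_digraph \<Rightarrow> ereal" where
  "graph_diameter G = (SUP u\<in>verts G. SUP v\<in>verts G. wf_digraph.\<mu> G (\<lambda>_. 1) u v)"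

lemma pair_bidirected_digraph_weak_minus_zero_divisor_graph:
  assumes "cring R"
  shows "pair_bidirected_digraph (weak_minus_zero_divisor_graph R)"
proof -
  interpret cring R by fact
  have mem: "x \<in> carrier R" if "x \<in> nonzero_zero_divisors R" for x
    using that by (simp add: nonzero_zero_divisors_def zero_divisors_def)
  have ann: "r \<in> carrier R" if "r \<in> annihilator R x - {\<zero>\<^bsub>R\<^esub>}" for r x
    using that by (simp add: annihilator_def)
  have sym1: "(y, x) \<in> parcs (zero_divisor_graph R)"
    if "(x, y) \<in> parcs (zero_divisor_graph R)" for x y
    using that m_comm[OF mem mem, of x y] by (auto simp: zero_divisor_graph_def)
  have sym2: "(y, x) \<in> parcs (weak_zero_divisor_graph R)"
    if "(x, y) \<in> parcs (weak_zero_divisor_graph R)" for x y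
  proof -
    from that obtain r s where rs: "r \<in> annihilator R x - {\<zero>\<^bsub>R\<^esub>}" "s \<in> annihilator R y - {\<zero>\<^bsub>R\<^esub>}"
      "r \<otimes>\<^bsub>R\<^esub> s = \<zero>\<^bsub>R\<^esub>" and xy: "x \<in> nonzero_zero_divisors R" "y \<in> nonzero_zero_divisors R" "x \<noteq> y"
      unfolding weak_zero_divisor_graph_def by auto
    have "s \<otimes>\<^bsub>R\<^esub> r = \<zero>\<^bsub>R\<^esub>"
      using rs m_comm[OF ann[OF rs(1)] ann[OF rs(2)]] by simp
    with rs xy show ?thesis
      unfolding weak_zero_divisor_graph_def pair_pre_digraph.simps by blast
  qed
  show ?thesis
  proof
    show "symmetric (weak_minus_zero_divisor_graph R)"
      unfolding symmetric_def with_proj_simps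
      by (rule symI) (simp add: weak_minus_zero_divisor_graph_def, blast intro: sym1 sym2)
  qed (auto simp: weak_minus_zero_divisor_graph_def weak_zero_divisor_graph_def)
qed

lemma pair_bidirected_digraph_weak_zero_divisor_difference_graph:
  assumes "cring R"
  shows "pair_bidirected_digraph (weak_zero_divisor_difference_graph R)"
proof -
  interpret G: pair_bidirected_digraph "weak_minus_zero_divisor_graph R"
    by (rule pair_bidirected_digraph_weak_minus_zero_divisor_graph[OF assms])
  show ?thesis
  proof
    show "symmetric (weak_zero_divisor_difference_graph R)"
      using G.pair_sym_arcs
      by (simp add: symmetric_def weak_zero_divisor_difference_graph_def Let_def)
  qed (auto simp: weak_zero_divisor_difference_graph_def Let_def isolated_verts_def
         dest: G.in_arcsD1 G.in_arcsD2 G.pair_no_loops)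
qed

end

theory Submission
  imports Defs
begin

text \<open>Zero divisors are adjacent as soon as their supports meet and differ: they vanish at two
  different coordinates, whose indicators are orthogonal annihilators. Elements with disjoint supports
  are joined through the indicator of \<open>{i, j}\<close>, where \<open>i\<close> and \<open>j\<close> lie in the two supports; it is a
  zero divisor since there are at least three factors. Elements with equal supports are joined
  through an indicator of one or two coordinates whose support meets theirs and differs from it.
  Indicators of two distinct coordinates annihilate each other, so they are at distance exactly \<open>2\<close>.\<close>

section \<open>Coordinates in a direct product of rings\<close>

lemma length_RDirProd_list_zero [simp]: "length \<zero>\<^bsub>RDirProd_list Rs\<^esub> = length Rs"
  unfolding RDirProd_list_zero by (induction Rs) auto

lemma nth_RDirProd_list_zero [simp]:
  "i < length Rs \<Longrightarrow> \<zero>\<^bsub>RDirProd_list Rs\<^esub> ! i = \<zero>\<^bsub>Rs ! i\<^esub>"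
  unfolding RDirProd_list_zero by (induction Rs arbitrary: i) (auto simp: nth_Cons split: nat.split)

text \<open>Consing \<open>(x, xs) \<mapsto> x # xs\<close> is a ring homomorphism out of the binary
  product, where multiplication is componentwise by definition.\<close>

lemma RDirProd_list_mult_Cons:
  assumes "x \<in> carrier R" "y \<in> carrier R"
    and "xs \<in> carrier (RDirProd_list Rs)" "ys \<in> carrier (RDirProd_list Rs)"
  shows "(x # xs) \<otimes>\<^bsub>RDirProd_list (R # Rs)\<^esub> (y # ys) =
         (x \<otimes>\<^bsub>R\<^esub> y) # (xs \<otimes>\<^bsub>RDirProd_list Rs\<^esub> ys)"
  using ring_hom_mult[OF RDirProd_list_hom1[of R Rs], of "(x, xs)" "(y, ys)"] assms
  by (simp add: RDirProd_carrier) (simp add: RDirProd_def DirProd_def monoid.defs)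

text \<open>Iterating the \<open>Cons\<close> rule makes products coordinatewise. Indexing by
  position is needed because the ring changes with the coordinate.\<close>

lemma RDirProd_list_mult_conv:
  assumes "x \<in> carrier (RDirProd_list Rs)" "y \<in> carrier (RDirProd_list Rs)"
  shows "x \<otimes>\<^bsub>RDirProd_list Rs\<^esub> y = map (\<lambda>i. x ! i \<otimes>\<^bsub>Rs ! i\<^esub> y ! i) [0..<length Rs]"
  using assms
proof (induction Rs arbitrary: x y)
  case Nil
  then show ?case by (simp add: monoid.defs)
next
  case (Cons R Rs)
  from Cons.prems obtain a as b bs where
    "x = a # as" "a \<in> carrier R" "as \<in> carrier (RDirProd_list Rs)"
    "y = b # bs" "b \<in> carrier R" "bs \<in> carrier (RDirProd_list Rs)"
    by (auto simp: RDirProd_list_carrier)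
  with Cons.IH[of as bs] show ?case
    by (simp add: RDirProd_list_mult_Cons map_upt_Suc del: upt_Suc)
qed

lemma cring_RDirProd_list:
  assumes "\<And>S. S \<in> set Rs \<Longrightarrow> cring S"
  shows "cring (RDirProd_list Rs)"
proof -
  interpret ring "RDirProd_list Rs"
    by (rule RDirProd_list_is_ring) (auto intro!: cring.axioms(1) assms)
  show ?thesis
  proof
    fix x y assume "x \<in> carrier (RDirProd_list Rs)" "y \<in> carrier (RDirProd_list Rs)"
    then show "x \<otimes>\<^bsub>RDirProd_list Rs\<^esub> y = y \<otimes>\<^bsub>RDirProd_list Rs\<^esub> x"
      by (auto simp: RDirProd_list_mult_conv RDirProd_list_carrier_mem
               intro!: cring.cring_simprules(14) assms)
  qed
qed

section \<open>Graphs in which any two vertices are adjacent or have a common neighbour\<close>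

context pair_bidirected_digraph
begin

text \<open>Every vertex reaches every other in at most two arcs. The vertex \<open>a\<close>
  supplies the nonemptiness that connectedness demands.\<close>

lemma connected_of_common_neighbours:
  assumes "a \<in> pverts G"
    and near: "\<And>x y. \<lbrakk>x \<in> pverts G; y \<in> pverts G; x \<noteq> y\<rbrakk> \<Longrightarrow>
      (x, y) \<in> parcs G \<or> (\<exists>z. (x, z) \<in> parcs G \<and> (z, y) \<in> parcs G)"
  shows "Digraph_Component.connected G"
  unfolding Digraph_Component.connected_def
proof (rule strongly_connectedI)
  show "verts (with_proj (mk_symmetric G)) \<noteq> {}"
    using assms(1) by auto
next
  fix x y assume "x \<in> verts (with_proj (mk_symmetric G))" "y \<in> verts (with_proj (mk_symmetric G))"
  then have xy: "x \<in> pverts G" "y \<in> pverts G" by auto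
  have "x \<rightarrow>\<^sup>*\<^bsub>G\<^esub> y"
  proof (cases "x = y")
    case False
    from near[OF xy False] show ?thesis
      by (auto intro: reachable_trans)
  qed (use xy in auto)
  then show "x \<rightarrow>\<^sup>*\<^bsub>mk_symmetric G\<^esub> y"
    by (rule reachable_mk_symmetricI)
qed

text \<open>With unit costs \<open>\<mu>\<close> minimises walk length: \<open>near\<close> gives
  walks of at most two arcs, and \<open>far\<close> excludes shorter walks for one pair.\<close>

lemma graph_diameter_eq_2:
  assumes near: "\<And>x y. \<lbrakk>x \<in> pverts G; y \<in> pverts G; x \<noteq> y\<rbrakk> \<Longrightarrow>
      (x, y) \<in> parcs G \<or> (\<exists>z. (x, z) \<in> parcs G \<and> (z, y) \<in> parcs G)"
    and far: "a \<in> pverts G" "b \<in> pverts G" "a \<noteq> b" "(a, b) \<notin> parcs G"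
  shows "graph_diameter G = 2"
proof (rule antisym)
  have cost: "awalk_cost (\<lambda>_. 1) p = real (length p)" for p :: "('a \<times> 'a) list"
    by (induction p) auto
  have "\<mu> (\<lambda>_. 1) x y \<le> 2" if xy: "x \<in> pverts G" "y \<in> pverts G" for x y
  proof -
    obtain p where p: "awalk x p y" "length p \<le> 2"
    proof (cases "x = y")
      case True
      with xy that[of "[]"] show thesis by (simp add: awalk_Nil_iff)
    next
      case False
      from near[OF xy False] show thesis
      proof (elim disjE exE conjE)
        assume "(x, y) \<in> parcs G"
        with xy that[of "[(x, y)]"] show thesis by (simp add: awalk_def)
      next
        fix z assume "(x, z) \<in> parcs G" "(z, y) \<in> parcs G"
        with xy that[of "[(x, z), (z, y)]"] show thesis by (simp add: awalk_def)
      qed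
    qed
    have "\<mu> (\<lambda>_. 1) x y \<le> ereal (real (length p))"
      using min_cost_le_walk_cost[OF p(1), of "\<lambda>_. 1"] by (simp add: cost)
    also have "\<dots> \<le> 2" using p(2) by simp
    finally show ?thesis .
  qed
  then show "graph_diameter G \<le> 2"
    by (auto simp: graph_diameter_def intro!: SUP_least)
  have "2 \<le> \<mu> (\<lambda>_. 1) a b"
    unfolding \<mu>_def
  proof (rule INF_greatest)
    fix p assume "p \<in> {p. awalk a p b}"
    with far have "2 \<le> length p"
      \<comment> \<open>The split is by zero, one or at least two arcs: an empty walk would force
        \<open>a = b\<close>, and a single arc would be \<open>(a, b)\<close>.\<close>
      by (cases p rule: remdups_adj.cases) (auto simp: awalk_def)
    then show "2 \<le> ereal (awalk_cost (\<lambda>_. 1) p)" by (simp add: cost)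
  qed
  also have "\<dots> \<le> graph_diameter G"
    unfolding graph_diameter_def using far(1,2)
    by (intro SUP_upper2[of a] SUP_upper2[of b] order_refl) auto
  finally show "2 \<le> graph_diameter G" .
qed

end

section \<open>The difference graph of a product of fields\<close>

locale field_product =
  fixes Fs :: "'a ring list"
  assumes field: "\<And>i. i < length Fs \<Longrightarrow> field (Fs ! i)"
begin

abbreviation "P \<equiv> RDirProd_list Fs"

text \<open>These idempotents realise every set of coordinates as a support, so they serve as the
  source of all annihilators and intermediate vertices below.\<close>

definition indicator_elt :: "nat set \<Rightarrow> 'a list" where
  "indicator_elt A = map (\<lambda>i. if i \<in> A then \<one>\<^bsub>Fs ! i\<^esub> else \<zero>\<^bsub>Fs ! i\<^esub>) [0..<length Fs]"

definition supp :: "'a list \<Rightarrow> nat set" where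
  "supp x = {i. i < length Fs \<and> x ! i \<noteq> \<zero>\<^bsub>Fs ! i\<^esub>}"

lemma cring: "cring P"
  using field by (intro cring_RDirProd_list) (auto simp: in_set_conv_nth intro: fieldE(1))

lemma zero_iff: "x \<in> carrier P \<Longrightarrow> x = \<zero>\<^bsub>P\<^esub> \<longleftrightarrow> supp x = {}"
  by (auto simp: supp_def list_eq_iff_nth_eq RDirProd_list_carrier_mem)

text \<open>Each factor is a domain, so a coordinate of the product vanishes exactly when one of the
  two factors vanishes there.\<close>

lemma supp_mult:
  assumes "x \<in> carrier P" "y \<in> carrier P"
  shows "supp (x \<otimes>\<^bsub>P\<^esub> y) = supp x \<inter> supp y"
proof -
  have *: "x ! i \<otimes>\<^bsub>Fs ! i\<^esub> y ! i = \<zero>\<^bsub>Fs ! i\<^esub> \<longleftrightarrow> x ! i = \<zero>\<^bsub>Fs ! i\<^esub> \<or> y ! i = \<zero>\<^bsub>Fs ! i\<^esub>"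
    if "i < length Fs" for i
    using that assms by (intro domain.integral_iff field.axioms(1) field)
      (auto dest: RDirProd_list_carrier_mem)
  show ?thesis
    by (simp add: set_eq_iff supp_def RDirProd_list_mult_conv[OF assms] * cong: conj_cong)
qed

lemma mult_eq_zero_iff:
  assumes "x \<in> carrier P" "y \<in> carrier P"
  shows "x \<otimes>\<^bsub>P\<^esub> y = \<zero>\<^bsub>P\<^esub> \<longleftrightarrow> supp x \<inter> supp y = {}"
proof -
  interpret cring P by (rule cring)
  show ?thesis using assms by (simp add: zero_iff supp_mult)
qed

lemma indicator_elt_carrier: "indicator_elt A \<in> carrier P"
proof (rule RDirProd_list_carrier_memI)
  fix i assume i: "i < length Fs"
  interpret field "Fs ! i" using i by (rule field)
  show "indicator_elt A ! i \<in> carrier (Fs ! i)"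
    using i by (simp add: indicator_elt_def)
qed (simp add: indicator_elt_def)

lemma supp_indicator_elt:
  assumes "A \<subseteq> {..<length Fs}"
  shows "supp (indicator_elt A) = A"
proof -
  have "\<one>\<^bsub>Fs ! i\<^esub> \<noteq> \<zero>\<^bsub>Fs ! i\<^esub>" if "i < length Fs" for i
    using domain.one_not_zero field.axioms(1) field that by blast
  with assms show ?thesis
    by (auto simp: supp_def indicator_elt_def split: if_splits)
qed

lemma supp_subset: "supp x \<subseteq> {..<length Fs}"
  by (auto simp: supp_def)

text \<open>A coordinate outside the support gives an indicator that annihilates \<open>x\<close>.
  Conversely, an annihilator of an element with full support has empty support.\<close>

lemma nonzero_zero_divisors_iff:
  "x \<in> nonzero_zero_divisors P \<longleftrightarrow> x \<in> carrier P \<and> supp x \<noteq> {} \<and> supp x \<noteq> {..<length Fs}"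
proof (cases "x \<in> carrier P")
  case True
  have "(\<exists>y\<in>carrier P. y \<noteq> \<zero>\<^bsub>P\<^esub> \<and> x \<otimes>\<^bsub>P\<^esub> y = \<zero>\<^bsub>P\<^esub>) \<longleftrightarrow> supp x \<noteq> {..<length Fs}"
  proof
    assume "\<exists>y\<in>carrier P. y \<noteq> \<zero>\<^bsub>P\<^esub> \<and> x \<otimes>\<^bsub>P\<^esub> y = \<zero>\<^bsub>P\<^esub>"
    then show "supp x \<noteq> {..<length Fs}"
      using True supp_subset by (auto simp: mult_eq_zero_iff zero_iff)
  next
    assume "supp x \<noteq> {..<length Fs}"
    then obtain i where "i < length Fs" "i \<notin> supp x"
      using supp_subset by blast
    then show "\<exists>y\<in>carrier P. y \<noteq> \<zero>\<^bsub>P\<^esub> \<and> x \<otimes>\<^bsub>P\<^esub> y = \<zero>\<^bsub>P\<^esub>"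
      using True by (intro bexI[of _ "indicator_elt {i}"])
        (auto simp: mult_eq_zero_iff zero_iff indicator_elt_carrier supp_indicator_elt)
  qed
  with True show ?thesis
    by (auto simp: nonzero_zero_divisors_def zero_divisors_def zero_iff)
qed (auto simp: nonzero_zero_divisors_def zero_divisors_def)

section \<open>Adjacency in terms of supports\<close>

abbreviation "G \<equiv> weak_minus_zero_divisor_graph P"

text \<open>Removing the arcs of the zero-divisor graph leaves only pairs with nonzero
  product.\<close>

lemma arc_supp_meet:
  assumes "(x, y) \<in> parcs G"
  shows "supp x \<inter> supp y \<noteq> {}"
  using assms mult_eq_zero_iff
  by (auto simp: weak_minus_zero_divisor_graph_def weak_zero_divisor_graph_def
        zero_divisor_graph_def nonzero_zero_divisors_iff)

text \<open>The indicators of \<open>i\<close> and \<open>j\<close> are the orthogonal annihilators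
  that give a weak arc; the common coordinate of the supports keeps that arc from being
  removed.\<close>

lemma arcI:
  assumes "x \<in> nonzero_zero_divisors P" "y \<in> nonzero_zero_divisors P" "x \<noteq> y"
    and "supp x \<inter> supp y \<noteq> {}"
    and "i < length Fs" "i \<notin> supp x" "j < length Fs" "j \<notin> supp y" "i \<noteq> j"
  shows "(x, y) \<in> parcs G"
proof -
  have xy: "x \<in> carrier P" "y \<in> carrier P"
    using assms(1,2) by (auto simp: nonzero_zero_divisors_iff)
  have "indicator_elt {i} \<in> annihilator P x - {\<zero>\<^bsub>P\<^esub>}" "indicator_elt {j} \<in> annihilator P y - {\<zero>\<^bsub>P\<^esub>}"
    using assms xy by (auto simp: annihilator_def mult_eq_zero_iff zero_iff
        indicator_elt_carrier supp_indicator_elt)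
  moreover have "indicator_elt {i} \<otimes>\<^bsub>P\<^esub> indicator_elt {j} = \<zero>\<^bsub>P\<^esub>"
    using assms by (auto simp: mult_eq_zero_iff indicator_elt_carrier supp_indicator_elt)
  ultimately show ?thesis
    using assms xy by (auto simp: weak_minus_zero_divisor_graph_def weak_zero_divisor_graph_def
        zero_divisor_graph_def mult_eq_zero_iff)
qed

lemma arc_of_supp_neq:
  assumes x: "x \<in> nonzero_zero_divisors P" and y: "y \<in> nonzero_zero_divisors P"
    and meet: "supp x \<inter> supp y \<noteq> {}" and neq: "supp x \<noteq> supp y"
  shows "(x, y) \<in> parcs G"
proof -
  obtain i j where "i < length Fs" "i \<notin> supp x" "j < length Fs" "j \<notin> supp y" "i \<noteq> j"
  proof -
    obtain i where i: "i < length Fs" "i \<notin> supp x"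
      using x supp_subset[of x] by (force simp: nonzero_zero_divisors_iff)
    obtain j where j: "j < length Fs" "j \<notin> supp y"
      using y supp_subset[of y] by (force simp: nonzero_zero_divisors_iff)
    \<comment> \<open>If \<open>i = j\<close>, this index lies in neither support, while
      \<open>k\<close> lies in exactly one and so differs from it. Then \<open>k\<close> replaces
      whichever of \<open>i\<close>, \<open>j\<close> belongs to the support omitting
      \<open>k\<close>.\<close>
    from neq obtain k where k: "k < length Fs" "k \<in> supp x \<longleftrightarrow> k \<notin> supp y"
      using supp_subset by blast
    with i j that show thesis by metis
  qed
  with assms show ?thesis by (intro arcI) auto
qed

text \<open>This both rules out isolated vertices and provides the common neighbour of two elements
  with equal supports; the latter use is why the neighbour's support must differ.\<close>

lemma ex_arc:
  assumes three: "length Fs \<ge> 3" and x: "x \<in> nonzero_zero_divisors P"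
  shows "\<exists>y. (x, y) \<in> parcs G \<and> y \<in> nonzero_zero_divisors P \<and> supp y \<noteq> supp x"
proof -
  obtain i where i: "i < length Fs" "i \<in> supp x"
    using x supp_subset by (force simp: nonzero_zero_divisors_iff)
  \<comment> \<open>Containing \<open>i\<close> makes \<open>A\<close> meet \<open>supp x\<close>,
    and having fewer than three elements makes it proper. The choice \<open>{i}\<close> works unless
    it is \<open>supp x\<close> itself; then a second coordinate is added.\<close>
  obtain A where A: "A \<subseteq> {..<length Fs}" "i \<in> A" "card A < 3" "A \<noteq> supp x"
  proof (cases "supp x = {i}")
    case True
    obtain j where "j < length Fs" "j \<noteq> i"
    proof
      show "(if i = 0 then 1 else 0) < length Fs" using three by auto
    qed auto
    with i True that[of "{i, j}"] show ?thesis by auto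
  next
    case False
    with i that[of "{i}"] show ?thesis by auto
  qed
  have "A \<noteq> {..<length Fs}" using A(3) three by auto
  with A have z: "indicator_elt A \<in> nonzero_zero_divisors P"
    by (auto simp: nonzero_zero_divisors_iff indicator_elt_carrier supp_indicator_elt)
  with A i x have "(x, indicator_elt A) \<in> parcs G"
    by (intro arc_of_supp_neq) (auto simp: supp_indicator_elt)
  with z A show ?thesis by (auto simp: supp_indicator_elt)
qed

lemma arc_or_common_neighbour:
  assumes three: "length Fs \<ge> 3"
    and x: "x \<in> nonzero_zero_divisors P" and y: "y \<in> nonzero_zero_divisors P"
  shows "(x, y) \<in> parcs G \<or> (\<exists>z. (x, z) \<in> parcs G \<and> (z, y) \<in> parcs G)"
proof -
  consider "supp x \<inter> supp y \<noteq> {}" "supp x \<noteq> supp y" | "supp x \<inter> supp y = {}" | "supp x = supp y"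
    by blast
  then show ?thesis
  proof cases
    case 1
    with x y arc_of_supp_neq show ?thesis by blast
  next
    case 2
    obtain i j where ij: "i \<in> supp x" "j \<in> supp y"
      using x y by (auto simp: nonzero_zero_divisors_iff)
    then have sub: "{i, j} \<subseteq> {..<length Fs}" using supp_subset by blast
    have "card {i, j} < card {..<length Fs}" using three by (simp add: card_insert_if)
    then have "{i, j} \<noteq> {..<length Fs}" by force
    then have z: "indicator_elt {i, j} \<in> nonzero_zero_divisors P"
      using sub by (simp add: nonzero_zero_divisors_iff indicator_elt_carrier supp_indicator_elt)
    \<comment> \<open>By disjointness \<open>j\<close> is not in \<open>supp x\<close> and
      \<open>i\<close> is not in \<open>supp y\<close>, so \<open>{i, j}\<close> meets both supports
      and equals neither.\<close>
    have "(x, indicator_elt {i, j}) \<in> parcs G" "(indicator_elt {i, j}, y) \<in> parcs G"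
      using 2 ij by (auto intro!: arc_of_supp_neq x y z simp: supp_indicator_elt[OF sub])
    then show ?thesis by blast
  next
    case 3
    obtain z where z: "(x, z) \<in> parcs G" "z \<in> nonzero_zero_divisors P" "supp z \<noteq> supp x"
      using ex_arc[OF three x] by blast
    \<comment> \<open>As \<open>supp y\<close> is \<open>supp x\<close>, it too meets
      \<open>supp z\<close> and differs from it.\<close>
    have "(z, y) \<in> parcs G"
      using 3 z arc_supp_meet[OF z(1)] by (intro arc_of_supp_neq y) auto
    with z show ?thesis by blast
  qed
qed

end

theorem theorem4p2:
  fixes Fs :: "'a ring list" and R :: "'a list ring"
  assumes "length Fs \<ge> 3"
    and "\<And>F. F \<in> set Fs \<Longrightarrow> field F \<and> finite (carrier F)"
    and "R = RDirProd_list Fs"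
  shows "isolated_verts (weak_minus_zero_divisor_graph R) = {} \<and>
         weak_zero_divisor_difference_graph R = weak_minus_zero_divisor_graph R \<and>
         Digraph_Component.connected (weak_zero_divisor_difference_graph R) \<and>
         graph_diameter (weak_zero_divisor_difference_graph R) = 2"
proof -
  interpret field_product Fs
    by (rule field_product.intro) (simp add: assms(2))
  interpret G: pair_bidirected_digraph G
    by (rule pair_bidirected_digraph_weak_minus_zero_divisor_graph[OF cring])
  have verts: "pverts G = nonzero_zero_divisors P"
    by (simp add: weak_minus_zero_divisor_graph_def)
  have no_isolated: "isolated_verts G = {}"
    using ex_arc[OF assms(1)] by (auto simp: isolated_verts_def verts)
  then have eq: "weak_zero_divisor_difference_graph P = G"
    by (simp add: weak_zero_divisor_difference_graph_def Let_def)
  have near: "(x, y) \<in> parcs G \<or> (\<exists>z. (x, z) \<in> parcs G \<and> (z, y) \<in> parcs G)"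
    if "x \<in> pverts G" "y \<in> pverts G" "x \<noteq> y" for x y
    using arc_or_common_neighbour[OF assms(1)] that by (simp add: verts)
  have unit_vert: "indicator_elt {i} \<in> pverts G" if "i < length Fs" for i
  proof -
    have "card {i} \<noteq> card {..<length Fs}"
      using assms(1) by simp
    then have "{i} \<noteq> {..<length Fs}" by metis
    with that show ?thesis
      by (simp add: verts nonzero_zero_divisors_iff indicator_elt_carrier supp_indicator_elt)
  qed
  have supp_unit: "supp (indicator_elt {i}) = {i}" if "i < length Fs" for i
    using that by (simp add: supp_indicator_elt)
  have "0 < length Fs" "1 < length Fs"
    using assms(1) by auto
  \<comment> \<open>The supports \<open>{0}\<close> and \<open>{1}\<close> are distinct, so the
    elements differ, and disjoint, so there is no arc.\<close>
  then have far: "indicator_elt {0} \<in> pverts G" "indicator_elt {1} \<in> pverts G"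
    "indicator_elt {0} \<noteq> indicator_elt {1}" "(indicator_elt {0}, indicator_elt {1}) \<notin> parcs G"
    using unit_vert supp_unit[of 0] supp_unit[of 1] arc_supp_meet by fastforce+
  from no_isolated eq G.connected_of_common_neighbours[OF far(1) near]
    G.graph_diameter_eq_2[OF near far]
  show ?thesis by (simp add: assms(3))
qed

end
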